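(* The zero-parity (ZP) stabbing information identifies convex/reflex and hull vertices. That is, let $P$ and $P'$ be simple polygons with vertices in general position, with the same number of vertices and with the same ZP stabbing information (vertices being matched by their labels). Then for every label $i$: vertex $i$ of $P$ is convex if and only if vertex $i$ of $P'$ is convex (otherwise both are reflex), and vertex $i$ of $P$ is a vertex of the convex hull of $P$ if and only if vertex $i$ of $P'$ is a vertex of the convex hull of $P'$.
   Context: Polygons are simple polygons in the plane with vertices in general position (no three collinear), labeled by consecutive indices increasing in a counterclockwise traversal of the boundary. A vertex is convex if its interior angle is less than $\pi$ and reflex if its interior angle is greater than $\pi$. For an ordered pair of distinct vertices $(x,y)$ of $P$, let $L$ be the line through them; $L\setminus\{x,y\}$ has three components. $\mathrm{Tail}(x,y)$, $\mathrm{Body}(x,y)$, $\mathrm{Head}(x,y)$ denote the number of edges of $P$ that cross, respectively, the open ray of $L$ ending at $x$ and not containing $y$, the open segment between $x$ and $y$, and the open ray of $L$ starting at $y$ and not containing $x$. (If $xy$ is itself an edge of $P$, this edge is not counted.) The zero-parity of a nonnegative integer is one of the three values "zero", "odd", "even and $>0$". The zero-parity (ZP) stabbing information of $P$ is the collection of the zero-parities of $\mathrm{Tail}(x,y),\mathrm{Body}(x,y),\mathrm{Head}(x,y)$ for all pairs of vertices, indexed by the vertex labels. *)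

theory Defs
  imports "HOL-Complex_Analysis.Complex_Analysis"
begin

text \<open>
  The plane is the type \<^typ>\<open>complex\<close>. A polygon is the list of its vertices; the label of a
  vertex is its position in the list, and label arithmetic is modulo the length.
\<close>

fun polyline :: "complex list \<Rightarrow> real \<Rightarrow> complex" where
  "polyline [] = linepath 0 0"
| "polyline [a] = linepath a a"
| "polyline [a, b] = linepath a b"
| "polyline (a # b # c # vs) = linepath a b +++ polyline (b # c # vs)"

definition boundary_path :: "complex list \<Rightarrow> real \<Rightarrow> complex" where
  "boundary_path vs = polyline (vs @ [hd vs])"

definition polygon_interior :: "complex list \<Rightarrow> complex set" where
  "polygon_interior vs = inside (path_image (boundary_path vs))"

definition polygon_region :: "complex list \<Rightarrow> complex set" where
  "polygon_region vs = path_image (boundary_path vs) \<union> polygon_interior vs"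

definition general_position :: "complex list \<Rightarrow> bool" where
  "general_position vs \<longleftrightarrow>
     (\<forall>i<length vs. \<forall>j<length vs. \<forall>k<length vs.
        i \<noteq> j \<and> j \<noteq> k \<and> i \<noteq> k \<longrightarrow> \<not> collinear {vs ! i, vs ! j, vs ! k})"

text \<open>
  The boundary of a simple polygon has winding number 1 or -1, the same for all interior points;
  the last conjunct says that the labels increase counterclockwise.
\<close>

definition ccw_simple_polygon :: "complex list \<Rightarrow> bool" where
  "ccw_simple_polygon vs \<longleftrightarrow>
     length vs \<ge> 3 \<and> simple_path (boundary_path vs) \<and>
     (\<forall>z\<in>polygon_interior vs. winding_number (boundary_path vs) z = 1)"

text \<open>
  The interior angle at a vertex is the measure of the set of directions that point from the
  vertex into the interior of the polygon.
\<close>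

definition interior_angle :: "complex list \<Rightarrow> nat \<Rightarrow> real" where
  "interior_angle vs i =
     measure lebesgue {\<theta> \<in> {0..<2 * pi}.
       \<forall>\<^sub>F r in at_right 0. vs ! i + rcis r \<theta> \<in> polygon_interior vs}"

definition convex_vertex :: "complex list \<Rightarrow> nat \<Rightarrow> bool" where
  "convex_vertex vs i \<longleftrightarrow> interior_angle vs i < pi"

definition reflex_vertex :: "complex list \<Rightarrow> nat \<Rightarrow> bool" where
  "reflex_vertex vs i \<longleftrightarrow> interior_angle vs i > pi"

definition hull_vertex :: "complex list \<Rightarrow> nat \<Rightarrow> bool" where
  "hull_vertex vs i \<longleftrightarrow> (vs ! i) extreme_point_of (convex hull (polygon_region vs))"

definition tail_ray :: "complex \<Rightarrow> complex \<Rightarrow> complex set" where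
  "tail_ray x y = (\<lambda>t. x + t *\<^sub>R (y - x)) ` {..<0}"

definition head_ray :: "complex \<Rightarrow> complex \<Rightarrow> complex set" where
  "head_ray x y = (\<lambda>t. x + t *\<^sub>R (y - x)) ` {1<..}"

text \<open>
  The set \<open>R\<close> below is one of the three parts of the line through vertices \<open>i\<close> and \<open>j\<close>. In general
  position, an edge other than the one joining \<open>i\<close> and \<open>j\<close> that meets \<open>R\<close> has both endpoints off
  the line, so that meeting \<open>R\<close> in a relatively interior point of the edge is the same as
  crossing it.
\<close>

definition crossings :: "complex list \<Rightarrow> nat \<Rightarrow> nat \<Rightarrow> complex set \<Rightarrow> nat" where
  "crossings vs i j R =
     card {k. k < length vs \<and> {k, Suc k mod length vs} \<noteq> {i, j} \<and>
              open_segment (vs ! k) (vs ! (Suc k mod length vs)) \<inter> R \<noteq> {}}"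

definition tail_count :: "complex list \<Rightarrow> nat \<Rightarrow> nat \<Rightarrow> nat" where
  "tail_count vs i j = crossings vs i j (tail_ray (vs ! i) (vs ! j))"

definition body_count :: "complex list \<Rightarrow> nat \<Rightarrow> nat \<Rightarrow> nat" where
  "body_count vs i j = crossings vs i j (open_segment (vs ! i) (vs ! j))"

definition head_count :: "complex list \<Rightarrow> nat \<Rightarrow> nat \<Rightarrow> nat" where
  "head_count vs i j = crossings vs i j (head_ray (vs ! i) (vs ! j))"

datatype zero_parity = ZP_zero | ZP_odd | ZP_even_pos

definition zero_parity :: "nat \<Rightarrow> zero_parity" where
  "zero_parity m = (if m = 0 then ZP_zero else if odd m then ZP_odd else ZP_even_pos)"

definition zp_info :: "complex list \<Rightarrow> nat \<Rightarrow> nat \<Rightarrow> zero_parity \<times> zero_parity \<times> zero_parity" where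
  "zp_info vs i j =
     (zero_parity (tail_count vs i j), zero_parity (body_count vs i j),
      zero_parity (head_count vs i j))"

definition same_zp_info :: "complex list \<Rightarrow> complex list \<Rightarrow> bool" where
  "same_zp_info vs vs' \<longleftrightarrow>
     (\<forall>i<length vs. \<forall>j<length vs. i \<noteq> j \<longrightarrow> zp_info vs i j = zp_info vs' i j)"

end

theory Submission imports Defs begin

text \<open>
  Both properties are read off the tail counts alone.

  Vertex \<open>i\<close> is reflex iff the backward extension of the edge from \<open>i\<close> to \<open>i + 1\<close> starts inside the
  polygon, that is, iff the tail count of \<open>(i, i + 1)\<close> is odd. The parity comes from winding
  numbers: writing the winding number of the boundary as a telescoping sum of differences of a
  branch of the logarithm cut along a ray, every edge crossing the ray contributes \<open>1\<close> or \<open>-1\<close>,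
  and the winding number is \<open>1\<close> inside and \<open>0\<close> outside. Near vertex \<open>i\<close>, in the open convex cone
  spanned by its two edges, the ray parallel to the tail ray crosses in addition the other edge at
  \<open>i\<close>. So the interior directions form this cone, of angle less than \<open>\<pi>\<close>, if the tail count is even,
  and the complementary sector otherwise.

  Vertex \<open>i\<close> is a hull vertex iff all tail counts at \<open>i\<close> vanish. If they do, the part of the boundary
  not incident to \<open>i\<close> never points, as seen from \<open>i\<close>, opposite to a vertex; by continuity of the
  polar angle all other vertices lie in an open half-plane through \<open>i\<close>.
\<close>

section \<open>Winding numbers and crossings\<close>

text \<open>The cross product \<open>Im (cnj p * q)\<close>, twice the signed area of the triangle
  with corners 0, \<open>p\<close>, \<open>q\<close>.\<close>

definition xprod :: "complex \<Rightarrow> complex \<Rightarrow> real" where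
  "xprod p q = Re p * Im q - Re q * Im p"

text \<open>
  The line through \<open>p\<close> and \<open>q\<close> meets the real axis at \<open>xprod p q / (Im q - Im p)\<close>.
\<close>

definition crosses_neg :: "complex \<Rightarrow> complex \<Rightarrow> bool" where
  "crosses_neg p q \<longleftrightarrow> Im p * Im q < 0 \<and> xprod p q * (Im q - Im p) < 0"

text \<open>Eliminate \<open>s\<close> using the vanishing imaginary part. Multiplying by a square
  instead of dividing means that, for \<open>Im p \<noteq> Im q\<close>, the sign of
  \<open>Re w\<close> is read off the right-hand side without a case split.\<close>

lemma Re_on_real_axis:
  assumes "w = (1 - s) *\<^sub>R p + s *\<^sub>R q" and "Im w = 0"
  shows "Re w * (Im q - Im p)\<^sup>2 = xprod p q * (Im q - Im p)"
proof -
  have "(1 - s) * Im p + s * Im q = 0" using assms by simp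
  then have s: "s * (Im q - Im p) = - Im p" by (simp add: algebra_simps)
  have "Re w = Re p + s * (Re q - Re p)"
    unfolding assms(1) by (simp add: algebra_simps)
  then have "Re w * (Im q - Im p) = Re p * (Im q - Im p) + (s * (Im q - Im p)) * (Re q - Re p)"
    by (simp only:) (simp add: algebra_simps)
  also have "\<dots> = xprod p q"
    unfolding s by (simp add: xprod_def algebra_simps)
  finally show ?thesis by (simp add: power2_eq_square flip: mult.assoc)
qed

lemma segment_meets_real_axis:
  assumes "Im p * Im q < 0"
  obtains s where "0 < s" "s < 1" "Im ((1 - s) *\<^sub>R p + s *\<^sub>R q) = 0"
proof
  let ?s = "Im p / (Im p - Im q)"
  have d: "Im p - Im q \<noteq> 0" using assms by (auto simp: mult_less_0_iff)
  show "0 < ?s" "?s < 1" using assms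
    by (auto simp: mult_less_0_iff zero_less_divide_iff divide_less_eq)
  show "Im ((1 - ?s) *\<^sub>R p + ?s *\<^sub>R q) = 0"
    using d by (simp add: field_simps)
qed

lemma same_sign_off_real_axis:
  assumes "Im p * Im q > 0" "0 \<le> s" "s \<le> 1"
  shows "Im ((1 - s) *\<^sub>R p + s *\<^sub>R q) \<noteq> 0"
proof -
  have "(1 - s) * Im p + s * Im q \<noteq> 0"
  proof (cases "Im p > 0")
    case True
    then have "Im q > 0" using assms by (simp add: zero_less_mult_iff)
    then show ?thesis using True assms
      by (cases "s = 0") (auto intro!: add_nonneg_pos order.strict_implies_not_eq[symmetric])
  next
    case False
    then have neg: "Im p < 0" "Im q < 0" using assms by (auto simp: zero_less_mult_iff)
    have "(1 - s) * Im p + s * Im q < 0"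
    proof (cases "s = 0")
      case False
      then show ?thesis using assms neg
        by (intro add_nonpos_neg mult_nonneg_nonpos mult_pos_neg) auto
    qed (use neg in auto)
    then show ?thesis by linarith
  qed
  then show ?thesis by simp
qed

text \<open>The hypothesis excludes segments inside the real axis, which may meet the negative half
  while \<open>crosses_neg\<close> is false. With just one end on the axis, the open segment misses
  the axis and both sides fail.\<close>

lemma open_segment_meets_neg_iff:
  assumes "Im p \<noteq> 0 \<or> Im q \<noteq> 0"
  shows "(\<exists>w \<in> open_segment p q. Im w = 0 \<and> Re w < 0) \<longleftrightarrow> crosses_neg p q"
proof
  assume "\<exists>w \<in> open_segment p q. Im w = 0 \<and> Re w < 0"
  then obtain w where w: "w \<in> open_segment p q" "Im w = 0" "Re w < 0" by blast
  then obtain s where s: "0 < s" "s < 1" "w = (1 - s) *\<^sub>R p + s *\<^sub>R q"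
    by (auto simp: in_segment)
  have e: "(1 - s) * Im p + s * Im q = 0" using w s by simp
  have le: "\<not> Im p * Im q > 0"
    using same_sign_off_real_axis[of p q s] s w by auto
  have "Im p \<noteq> 0" "Im q \<noteq> 0"
    using e s assms by auto
  with le have m: "Im p * Im q < 0" by (metis linorder_neqE_linordered_idom mult_eq_0_iff)
  then have "(Im q - Im p)\<^sup>2 > 0" by (auto simp: mult_less_0_iff)
  then show "crosses_neg p q"
    using Re_on_real_axis[OF s(3) w(2)] w(3) m
    unfolding crosses_neg_def by (metis mult_neg_pos)
next
  assume c: "crosses_neg p q"
  then have m: "Im p * Im q < 0" by (simp add: crosses_neg_def)
  obtain s where s: "0 < s" "s < 1" "Im ((1 - s) *\<^sub>R p + s *\<^sub>R q) = 0"
    using segment_meets_real_axis[OF m] .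
  let ?w = "(1 - s) *\<^sub>R p + s *\<^sub>R q"
  have "p \<noteq> q" using m by (auto simp: mult_less_0_iff)
  then have "?w \<in> open_segment p q" using s by (auto simp: in_segment)
  moreover have "Re ?w < 0"
    using Re_on_real_axis[OF refl s(3)] c unfolding crosses_neg_def
    by (metis mult_less_0_iff not_less zero_le_power2)
  ultimately show "\<exists>w \<in> open_segment p q. Im w = 0 \<and> Re w < 0" using s by blast
qed

text \<open>Under the first alternative the segment misses the real axis; under the second,
  \<open>Re_on_real_axis\<close> makes the real part nonzero at any point on the axis. The same
  disjunction serves below to keep the base point of a ray off an edge.\<close>

lemma zero_notin_closed_segment:
  assumes "Im p * Im q > 0 \<or> xprod p q * (Im q - Im p) \<noteq> 0"
  shows "0 \<notin> closed_segment p q"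
proof
  assume "0 \<in> closed_segment p q"
  then obtain s where s: "0 \<le> s" "s \<le> 1" "0 = (1 - s) *\<^sub>R p + s *\<^sub>R q"
    by (auto simp: in_segment)
  show False
    using assms same_sign_off_real_axis[of p q s] s Re_on_real_axis[OF s(3)]
    by (metis mult_zero_left zero_complex.sel(1) zero_complex.sel(2))
qed

text \<open>The affine map \<open>w \<mapsto> (w - z) / a\<close> turns the open ray from
  \<open>z\<close> in direction \<open>- a\<close> into the negative real axis, the branch cut of
  \<open>Ln\<close>. All crossing arguments take place in these coordinates.\<close>

lemma closed_segment_scale:
  fixes a :: complex
  assumes "a \<noteq> 0"
  shows "w \<in> closed_segment p q \<longleftrightarrow> (w - z) / a \<in> closed_segment ((p - z) / a) ((q - z) / a)"
proof -
  have "(1 - u) *\<^sub>R ((p - z) / a) + u *\<^sub>R ((q - z) / a) = ((1 - u) *\<^sub>R p + u *\<^sub>R q - z) / a" for u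
    using assms by (simp add: scaleR_conv_of_real field_simps)
  then show ?thesis using assms by (simp add: in_segment)
qed

lemma open_segment_scale:
  fixes a :: complex
  assumes "a \<noteq> 0"
  shows "w \<in> open_segment p q \<longleftrightarrow> (w - z) / a \<in> open_segment ((p - z) / a) ((q - z) / a)"
  using closed_segment_scale[OF assms, of w p q z] assms
  by (auto simp: open_segment_def)

lemma winding_number_linepath_primitive:
  assumes "\<And>w. w \<in> closed_segment p q \<Longrightarrow> (f has_field_derivative 1 / (w - z)) (at w)"
    and "z \<notin> closed_segment p q"
  shows "winding_number (linepath p q) z = (f q - f p) / (2 * pi * \<i>)"
proof -
  have "((\<lambda>w. 1 / (w - z)) has_contour_integral (f (pathfinish (linepath p q)) - f (pathstart (linepath p q)))) (linepath p q)"
    by (rule contour_integral_primitive[of "closed_segment p q"])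
       (auto intro: assms has_field_derivative_at_within)
  then have "contour_integral (linepath p q) (\<lambda>w. 1 / (w - z)) = f q - f p"
    by (simp add: contour_integral_unique)
  then show ?thesis
    using assms by (subst winding_number_valid_path) auto
qed

text \<open>If the segment avoids the cut, \<open>Ln ((w - z) / a)\<close> is a primitive along it
  and \<open>m = 0\<close>. If it crosses the cut, it avoids the positive real axis, so
  \<open>Ln (- ((w - z) / a))\<close> is a primitive; passing back to \<open>Ln\<close> adds
  \<open>pi * \<i>\<close> at one end and subtracts it at the other, so \<open>m\<close> is
  \<open>1\<close> or \<open>-1\<close>.\<close>

lemma winding_number_linepath_crossing:
  fixes a p q z :: complex
  defines "P \<equiv> (p - z) / a" and "Q \<equiv> (q - z) / a"
  assumes a: "a \<noteq> 0" and P: "Im P \<noteq> 0" and Q: "Im Q \<noteq> 0"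
    and off: "Im P * Im Q > 0 \<or> xprod P Q * (Im Q - Im P) \<noteq> 0"
  shows "\<exists>m::int. winding_number (linepath p q) z = (Ln Q - Ln P) / (2 * pi * \<i>) + of_int m
           \<and> (odd m \<longleftrightarrow> crosses_neg P Q)"
proof -
  have z: "z \<notin> closed_segment p q"
    using zero_notin_closed_segment[OF off] closed_segment_scale[OF a, of z p q z]
    by (simp add: P_def Q_def)
  have seg: "\<exists>s. 0 \<le> s \<and> s \<le> 1 \<and> (w - z) / a = (1 - s) *\<^sub>R P + s *\<^sub>R Q"
    if "w \<in> closed_segment p q" for w
    using iffD1[OF closed_segment_scale[OF a] that, of z] unfolding P_def Q_def
    by (simp add: in_segment)
  show ?thesis
  proof (cases "crosses_neg P Q")
    case False
    have "(w - z) / a \<notin> \<real>\<^sub>\<le>\<^sub>0" if w: "w \<in> closed_segment p q" for w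
    proof
      assume n: "(w - z) / a \<in> \<real>\<^sub>\<le>\<^sub>0"
      let ?w = "(w - z) / a"
      have r: "Im ?w = 0" "Re ?w \<le> 0" using n by (simp_all only: complex_nonpos_Reals_iff)
      obtain s where s: "0 \<le> s" "s \<le> 1" "?w = (1 - s) *\<^sub>R P + s *\<^sub>R Q"
        using seg[OF w] by blast
      have "\<not> Im P * Im Q > 0" using same_sign_off_real_axis[of P Q s] s r by auto
      then have m: "Im P * Im Q < 0" and D: "xprod P Q * (Im Q - Im P) \<noteq> 0"
        using P Q off by (auto simp: not_less less_le)
      have "xprod P Q * (Im Q - Im P) \<le> 0"
        unfolding Re_on_real_axis[OF s(3) r(1), symmetric]
        using r by (simp add: mult_nonpos_nonneg)
      with D m False show False by (auto simp: crosses_neg_def)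
    qed
    then have "((\<lambda>w. Ln ((w - z) / a)) has_field_derivative 1 / (w - z)) (at w)"
      if "w \<in> closed_segment p q" for w
      using that a z by (auto intro!: derivative_eq_intros simp: field_simps)
    from winding_number_linepath_primitive[OF this z] False show ?thesis
      by (intro exI[of _ 0]) (simp add: P_def Q_def)
  next
    case True
    then have m: "Im P * Im Q < 0" and D: "xprod P Q * (Im Q - Im P) < 0"
      by (auto simp: crosses_neg_def)
    have "- ((w - z) / a) \<notin> \<real>\<^sub>\<le>\<^sub>0" if w: "w \<in> closed_segment p q" for w
    proof
      assume n: "- ((w - z) / a) \<in> \<real>\<^sub>\<le>\<^sub>0"
      let ?w = "(w - z) / a"
      have r: "Im ?w = 0" "Re ?w \<ge> 0"
        using n by (simp_all only: complex_nonpos_Reals_iff uminus_complex.sel neg_equal_0_iff_equal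
            neg_le_0_iff_le)
      obtain s where s: "0 \<le> s" "s \<le> 1" "?w = (1 - s) *\<^sub>R P + s *\<^sub>R Q"
        using seg[OF w] by blast
      have "xprod P Q * (Im Q - Im P) \<ge> 0"
        unfolding Re_on_real_axis[OF s(3) r(1), symmetric]
        using r by simp
      with D show False by simp
    qed
    then have "((\<lambda>w. Ln (- ((w - z) / a))) has_field_derivative 1 / (w - z)) (at w)"
      if "w \<in> closed_segment p q" for w
      using that a z by (auto intro!: derivative_eq_intros simp: field_simps)
    from winding_number_linepath_primitive[OF this z]
    have w: "winding_number (linepath p q) z = (Ln (- Q) - Ln (- P)) / (2 * pi * \<i>)"
      by (simp add: P_def Q_def)
    have nz: "P \<noteq> 0" "Q \<noteq> 0" using P Q by auto
    show ?thesis
    proof (cases "Im P > 0")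
      case pos: True
      then have "Im Q < 0" using m by (simp add: mult_less_0_iff)
      then have "Ln (- Q) - Ln (- P) = Ln Q - Ln P + 2 * pi * \<i>"
        using nz pos by (simp add: Ln_minus algebra_simps)
      then show ?thesis using True unfolding w
        by (intro exI[of _ 1]) (simp add: add_divide_distrib)
    next
      case neg: False
      then have "Im Q > 0" "Im P < 0" using m P by (auto simp: mult_less_0_iff)
      then have "Ln (- Q) - Ln (- P) = Ln Q - Ln P - 2 * pi * \<i>"
        using nz by (simp add: Ln_minus algebra_simps)
      then show ?thesis using True unfolding w
        by (intro exI[of _ "-1"]) (simp add: diff_divide_distrib)
    qed
  qed
qed

section \<open>Winding numbers of closed polygonal paths\<close>

lemma pathstart_polyline: "vs \<noteq> [] \<Longrightarrow> pathstart (polyline vs) = hd vs"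
  by (induction vs rule: polyline.induct) auto

lemma pathfinish_polyline: "vs \<noteq> [] \<Longrightarrow> pathfinish (polyline vs) = last vs"
proof (induction vs rule: polyline.induct)
  case (4 a b c vs)
  then show ?case by simp
qed (simp_all only: polyline.simps pathfinish_linepath last.simps, simp_all)

lemma path_polyline: "path (polyline vs)"
proof (induction vs rule: polyline.induct)
  case (4 a b c vs)
  then show ?case by (simp add: pathstart_polyline)
qed (simp_all only: polyline.simps path_linepath)

lemma path_image_polyline:
  "length vs \<ge> 2 \<Longrightarrow>
   path_image (polyline vs) = (\<Union>k<length vs - 1. closed_segment (vs ! k) (vs ! Suc k))"
proof (induction vs rule: polyline.induct)
  case (4 a b c vs)
  show ?case
    using 4 by (simp add: path_image_join pathstart_polyline lessThan_Suc_eq_insert_0 image_image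
        del: lessThan_Suc)
qed (simp_all add: lessThan_Suc)

lemma winding_number_polyline:
  "length vs \<ge> 2 \<Longrightarrow> z \<notin> path_image (polyline vs) \<Longrightarrow>
   winding_number (polyline vs) z
     = (\<Sum>k<length vs - 1. winding_number (linepath (vs ! k) (vs ! Suc k)) z)"
proof (induction vs rule: polyline.induct)
  case (4 a b c vs)
  have "z \<notin> closed_segment a b" "z \<notin> path_image (polyline (b # c # vs))"
    using 4(3) by (auto simp: path_image_join pathstart_polyline)
  then have "winding_number (polyline (a # b # c # vs)) z
      = winding_number (linepath a b) z + winding_number (polyline (b # c # vs)) z"
    by (simp add: winding_number_join path_polyline pathstart_polyline)
  also have "winding_number (polyline (b # c # vs)) z = (\<Sum>k<length (b # c # vs) - 1.
      winding_number (linepath ((b # c # vs) ! k) ((b # c # vs) ! Suc k)) z)"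
    using 4(1) \<open>z \<notin> path_image (polyline (b # c # vs))\<close> by simp
  finally show ?case
    by (simp only: list.size sum.lessThan_Suc_shift nth_Cons_0 nth_Cons_Suc add_Suc_right
        add_0_right diff_Suc_1)
qed auto

lemma nth_closed:
  "vs \<noteq> [] \<Longrightarrow> k < length vs \<Longrightarrow> (vs @ [hd vs]) ! Suc k = vs ! (Suc k mod length vs)"
  by (cases "Suc k = length vs") (simp_all add: nth_append hd_conv_nth)

lemma path_image_boundary:
  assumes "vs \<noteq> []"
  shows "path_image (boundary_path vs)
           = (\<Union>k<length vs. closed_segment (vs ! k) (vs ! (Suc k mod length vs)))"
  unfolding boundary_path_def using assms
  by (subst path_image_polyline)
     (auto simp: nth_closed nth_append_left Suc_le_eq simp del: nth_append_length intro!: SUP_cong)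

lemma winding_number_boundary:
  assumes "vs \<noteq> []" "z \<notin> path_image (boundary_path vs)"
  shows "winding_number (boundary_path vs) z
           = (\<Sum>k<length vs. winding_number (linepath (vs ! k) (vs ! (Suc k mod length vs))) z)"
  using assms unfolding boundary_path_def
  by (subst winding_number_polyline)
     (auto simp: nth_closed nth_append_left Suc_le_eq intro!: sum.cong)

lemma sum_cyclic_telescope:
  fixes f :: "nat \<Rightarrow> 'a::ab_group_add"
  shows "(\<Sum>k<n. f (Suc k mod n) - f k) = 0"
proof (cases n)
  case (Suc m)
  have "(\<Sum>k<m. f (Suc k mod n) - f k) = (\<Sum>k<m. f (Suc k) - f k)"
    using Suc by (intro sum.cong) auto
  then show ?thesis using Suc by (simp add: sum_lessThan_telescope)
qed simp

text \<open>Ray casting along the ray from \<open>z\<close> in direction \<open>- a\<close>. The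
  logarithms telescope around the boundary, leaving the sum of the integers \<open>m k\<close>.
  Hypothesis \<open>Im\<close> keeps all vertices off the line of the ray, and \<open>off\<close>
  keeps \<open>z\<close> off the boundary.\<close>

lemma interior_iff_odd_crossings:
  fixes vs :: "complex list" and a z :: complex
  defines "C \<equiv> \<lambda>k. (vs ! k - z) / a"
  assumes vs: "ccw_simple_polygon vs" and a: "a \<noteq> 0"
    and Im: "\<And>k. k < length vs \<Longrightarrow> Im (C k) \<noteq> 0"
    and off: "\<And>k. k < length vs \<Longrightarrow> Im (C k) * Im (C (Suc k mod length vs)) > 0 \<or>
       xprod (C k) (C (Suc k mod length vs)) * (Im (C (Suc k mod length vs)) - Im (C k)) \<noteq> 0"
  shows "z \<in> polygon_interior vs \<longleftrightarrow>
    odd (card {k. k < length vs \<and> crosses_neg (C k) (C (Suc k mod length vs))})"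
proof -
  let ?n = "length vs" and ?W = "winding_number (boundary_path vs) z"
  have ne: "vs \<noteq> []" using vs by (auto simp: ccw_simple_polygon_def)
  have z: "z \<notin> path_image (boundary_path vs)"
  proof
    assume "z \<in> path_image (boundary_path vs)"
    then obtain k where k: "k < ?n" "z \<in> closed_segment (vs ! k) (vs ! (Suc k mod ?n))"
      by (auto simp: path_image_boundary[OF ne])
    then show False
      using zero_notin_closed_segment[OF off[OF k(1)]]
        closed_segment_scale[OF a, of z _ _ z] by (simp add: C_def)
  qed
  have "\<exists>m::int. winding_number (linepath (vs ! k) (vs ! (Suc k mod ?n))) z
      = (Ln (C (Suc k mod ?n)) - Ln (C k)) / (2 * pi * \<i>) + of_int m
      \<and> (odd m \<longleftrightarrow> crosses_neg (C k) (C (Suc k mod ?n)))" if "k < ?n" for k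
    using winding_number_linepath_crossing[OF a, of "vs ! k" z "vs ! (Suc k mod ?n)"]
      that Im off unfolding C_def by (simp add: ne)
  then obtain m :: "nat \<Rightarrow> int" where
    m: "\<And>k. k < ?n \<Longrightarrow> winding_number (linepath (vs ! k) (vs ! (Suc k mod ?n))) z
      = (Ln (C (Suc k mod ?n)) - Ln (C k)) / (2 * pi * \<i>) + of_int (m k)"
    and odd: "\<And>k. k < ?n \<Longrightarrow> odd (m k) \<longleftrightarrow> crosses_neg (C k) (C (Suc k mod ?n))"
    by metis
  have "?W = (\<Sum>k<?n. (Ln (C (Suc k mod ?n)) - Ln (C k)) / (2 * pi * \<i>) + of_int (m k))"
    unfolding winding_number_boundary[OF ne z] by (intro sum.cong) (auto simp: m)
  also have "\<dots> = (\<Sum>k<?n. Ln (C (Suc k mod ?n)) - Ln (C k)) / (2 * pi * \<i>) + of_int (\<Sum>k<?n. m k)"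
    unfolding sum.distrib sum_divide_distrib by simp
  also have "\<dots> = of_int (\<Sum>k<?n. m k)"
    by (simp only: sum_cyclic_telescope[where f = "\<lambda>k. Ln (C k)"] div_0 add_0)
  finally have W: "?W = of_int (\<Sum>k<?n. m k)" .
  have "{k \<in> {..<?n}. odd (m k)} = {k. k < ?n \<and> crosses_neg (C k) (C (Suc k mod ?n))}"
    using odd by auto
  then have par: "odd (\<Sum>k<?n. m k)
      \<longleftrightarrow> odd (card {k. k < ?n \<and> crosses_neg (C k) (C (Suc k mod ?n))})"
    using even_sum_iff[of "{..<?n}" m] by simp
  show ?thesis
  proof (cases "z \<in> polygon_interior vs")
    case True
    then have "?W = 1" using vs by (auto simp: ccw_simple_polygon_def)
    with W have "(\<Sum>k<?n. m k) = 1" by (metis of_int_eq_1_iff)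
    then show ?thesis using True par by simp
  next
    case False
    then have "z \<in> outside (path_image (boundary_path vs))"
      using z by (auto simp: polygon_interior_def outside_inside)
    then have "?W = 0"
      by (intro winding_number_zero_in_outside)
         (auto simp: boundary_path_def path_polyline pathstart_polyline pathfinish_polyline ne)
    with W have "(\<Sum>k<?n. m k) = 0" by (metis of_int_eq_0_iff)
    then show ?thesis using False par by simp
  qed
qed

section \<open>Measure of a sector of directions\<close>

lemma sector_borel:
  "{\<theta>. c * sin (\<theta> - \<alpha>) > 0 \<and> c * sin (\<theta> - \<beta>) < (0::real)} \<in> sets borel"
  by (intro borel_open open_Collect_conj open_Collect_less continuous_intros)

lemma lebesgue_of_borel: "A \<in> sets borel \<Longrightarrow> A \<in> sets lebesgue"
  by (metis sets_completionI_sets sets_lborel)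

text \<open>\<open>C\<close> consists of the directions in the open cone spanned by
  \<open>cis \<alpha>\<close> and \<open>cis \<beta>\<close>: by Cramer's rule the two conditions
  say that both coefficients are positive. The cone contains no two opposite directions, so its part
  in the first half-turn, shifted by \<open>pi\<close>, is disjoint from its part in the second.
  Both lie in an interval of length \<open>pi\<close>, and they miss a subinterval on which
  \<open>?f\<close> is positive, which makes the bound strict.\<close>

lemma measure_sector_less_pi:
  fixes \<alpha> \<beta> :: real
  defines "C \<equiv> {\<theta> \<in> {0..<2 * pi}. sin (\<beta> - \<alpha>) * sin (\<theta> - \<alpha>) > 0 \<and> sin (\<beta> - \<alpha>) * sin (\<theta> - \<beta>) < 0}"
  assumes s: "sin (\<beta> - \<alpha>) \<noteq> 0"
  shows "C \<in> lmeasurable" "measure lebesgue C < pi"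
proof -
  let ?f = "\<lambda>\<theta>. sin (\<theta> - \<alpha>) * sin (\<theta> - \<beta>)"
  define C1 where "C1 = C \<inter> {0..<pi}"
  define C2 where "C2 = C \<inter> {pi..<2 * pi}"
  define T where "T = (+) pi ` C1"
  have Cb: "C \<in> sets borel"
  proof -
    have "C = {0..<2 * pi} \<inter> {\<theta>. sin (\<beta> - \<alpha>) * sin (\<theta> - \<alpha>) > 0 \<and> sin (\<beta> - \<alpha>) * sin (\<theta> - \<beta>) < 0}"
      by (auto simp: C_def)
    then show ?thesis using sector_borel by auto
  qed
  have bnd: "bounded C" by (rule bounded_subset[OF bounded_closed_interval[of 0 "2*pi"]]) (auto simp: C_def)
  show Cm: "C \<in> lmeasurable"
    by (intro bounded_set_imp_lmeasurable bnd lebesgue_of_borel Cb)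
  have C12: "C1 \<in> lmeasurable" "C2 \<in> lmeasurable"
    unfolding C1_def C2_def using bnd Cb
    by (auto intro!: bounded_set_imp_lmeasurable lebesgue_of_borel bounded_Int)
  have Tm: "T \<in> lmeasurable" unfolding T_def by (rule measurable_translation[OF C12(1)])
  \<comment> \<open>The direction perpendicular to the bisector of \<open>\<alpha>\<close> and
    \<open>\<beta>\<close>, where \<open>?f\<close> takes the value
    \<open>(cos (\<beta> - \<alpha>) + 1) / 2\<close>. Then \<open>\<theta>0\<close> moves it by a
    multiple of \<open>pi\<close> into the second half-turn.\<close>
  define x where "x = (\<alpha> + \<beta> + pi) / 2"
  define \<theta>0 where "\<theta>0 = x - of_int \<lfloor>x / pi\<rfloor> * pi + pi"
  have fl: "of_int \<lfloor>x / pi\<rfloor> * pi \<le> x" "x < of_int \<lfloor>x / pi\<rfloor> * pi + pi"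
    using iffD1[OF pos_le_divide_eq[OF pi_gt_zero] of_int_floor_le]
      iffD1[OF pos_divide_less_eq[OF pi_gt_zero] floor_correct[THEN conjunct2]]
    by (simp_all add: distrib_right)
  have th: "pi \<le> \<theta>0" "\<theta>0 < 2 * pi"
    using fl by (auto simp: \<theta>0_def)
  have "?f \<theta>0 > 0"
  proof -
    have "?f \<theta>0 = (cos (\<beta> - \<alpha>) - cos (2 * \<theta>0 - \<alpha> - \<beta>)) / 2"
      by (simp add: sin_times_sin algebra_simps)
    also have "2 * \<theta>0 - \<alpha> - \<beta> = pi + 2 * pi * of_int (1 - \<lfloor>x / pi\<rfloor>)"
      by (simp add: \<theta>0_def x_def field_simps)
    also have "cos \<dots> = -1"
      by (simp only: cos_add cos_int_2pin sin_int_2pin) simp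
    finally have f: "?f \<theta>0 = (cos (\<beta> - \<alpha>) + 1) / 2" by simp
    have "cos (\<beta> - \<alpha>) \<noteq> -1"
      using s sin_cos_squared_add[of "\<beta> - \<alpha>"] by (auto simp del: sin_cos_squared_add)
    then have "cos (\<beta> - \<alpha>) > -1" using cos_ge_minus_one[of "\<beta> - \<alpha>"] by linarith
    then show ?thesis unfolding f by simp
  qed
  \<comment> \<open>One-sided, because \<open>\<theta>0\<close> may equal \<open>pi\<close>: an
    interval to its right still fits into the second half-turn.\<close>
  moreover have "(?f \<longlongrightarrow> ?f \<theta>0) (at_right \<theta>0)" by (intro tendsto_intros)
  ultimately have "\<forall>\<^sub>F \<theta> in at_right \<theta>0. ?f \<theta> > 0" using order_tendstoD(1) by blast
  then obtain c where c: "c > \<theta>0" "\<And>\<theta>. \<theta>0 < \<theta> \<Longrightarrow> \<theta> < c \<Longrightarrow> ?f \<theta> > 0"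
    unfolding eventually_at_right_field by blast
  define d where "d = min c (2 * pi)"
  have d: "d > \<theta>0" "d \<le> 2 * pi" using c th by (auto simp: d_def)
  have "?f \<theta> < 0" if "\<theta> \<in> C" for \<theta>
  proof -
    have "(sin (\<beta> - \<alpha>) * sin (\<theta> - \<alpha>)) * (sin (\<beta> - \<alpha>) * sin (\<theta> - \<beta>)) < 0"
      using that by (intro mult_pos_neg[of "sin (\<beta> - \<alpha>) * sin (\<theta> - \<alpha>)"]) (auto simp: C_def)
    then have "(sin (\<beta> - \<alpha>))\<^sup>2 * ?f \<theta> < 0" by (simp add: power2_eq_square algebra_simps)
    then show ?thesis by (simp add: mult_less_0_iff)
  qed
  moreover have shift: "sin (pi + \<theta> - \<gamma>) = - sin (\<theta> - \<gamma>)" for \<theta> \<gamma>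
    using sin_periodic_pi[of "\<theta> - \<gamma>"] by (simp add: algebra_simps)
  then have "?f (pi + \<theta>) = ?f \<theta>" for \<theta> by simp
  ultimately have neg: "?f \<theta> < 0" if "\<theta> \<in> T \<union> C2" for \<theta>
    using that by (auto simp: T_def C1_def C2_def)
  have "T \<union> C2 \<subseteq> {pi..<2 * pi} - {\<theta>0<..<d}"
  proof
    fix \<theta> assume t: "\<theta> \<in> T \<union> C2"
    then have "\<theta> \<in> {pi..<2 * pi}" by (auto simp: T_def C1_def C2_def)
    moreover have "\<theta> \<notin> {\<theta>0<..<d}" using neg[OF t] c(2)[of \<theta>] by (auto simp: d_def)
    ultimately show "\<theta> \<in> {pi..<2 * pi} - {\<theta>0<..<d}" by blast
  qed
  then have "measure lebesgue (T \<union> C2) \<le> measure lebesgue ({pi..<2 * pi} - {\<theta>0<..<d})"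
    using Tm C12
    by (intro measure_mono_fmeasurable fmeasurable.Diff bounded_set_imp_lmeasurable) auto
  also have "\<dots> = measure lebesgue {pi..<2 * pi} - measure lebesgue {\<theta>0<..<d}"
    using th d by (intro measurable_measure_Diff bounded_set_imp_lmeasurable) auto
  also have "\<dots> < pi" using d th by simp
  finally have "measure lebesgue (T \<union> C2) < pi" .
  moreover have "T \<inter> C2 = {}"
  proof -
    have "pi + \<theta> \<notin> C2" if "\<theta> \<in> C1" for \<theta>
    proof
      assume "pi + \<theta> \<in> C2"
      then have "sin (\<beta> - \<alpha>) * sin (\<theta> - \<alpha>) < 0" by (simp add: C2_def C_def shift)
      with that show False by (simp add: C1_def C_def)
    qed
    then show ?thesis by (auto simp: T_def)
  qed
  then have "measure lebesgue (T \<union> C2) = measure lebesgue T + measure lebesgue C2"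
    using Tm C12 by (simp add: measure_Un3)
  moreover have "measure lebesgue T = measure lebesgue C1"
    unfolding T_def by (rule measure_translation)
  moreover have "measure lebesgue C = measure lebesgue C1 + measure lebesgue C2"
  proof -
    have "C = C1 \<union> C2" by (auto simp: C1_def C2_def C_def)
    moreover have "C1 \<inter> C2 = {}" by (auto simp: C1_def C2_def)
    ultimately show ?thesis using C12 by (simp add: measure_Un3)
  qed
  ultimately show "measure lebesgue C < pi" by linarith
qed

lemma negligible_sin_zero: "negligible {\<theta>. sin (\<theta> - \<alpha>) = (0::real)}"
proof -
  have "{\<theta>. sin (\<theta> - \<alpha>) = 0} \<subseteq> range (\<lambda>k::int. of_int k * pi + \<alpha>)"
    by (auto simp: sin_zero_iff_int2 image_iff) (metis diff_add_cancel)
  then have "countable {\<theta>. sin (\<theta> - \<alpha>) = 0}"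
    by (rule countable_subset) auto
  then show ?thesis
    unfolding negligible_iff_null_sets
    by (intro null_sets_completionI countable_imp_null_set_lborel)
qed

text \<open>The inequality between truth values is an exclusive or: up to the null set of directions
  on the two boundary lines, \<open>S\<close> is the cone if \<open>R\<close> is false and its
  complement in the full turn if \<open>R\<close> is true. The complement has measure above
  \<open>2 * pi - pi\<close>.\<close>

lemma measure_compare_sector:
  fixes \<alpha> \<beta> :: real and S :: "real set"
  defines "C \<equiv> \<lambda>\<theta>. sin (\<beta> - \<alpha>) * sin (\<theta> - \<alpha>) > 0 \<and> sin (\<beta> - \<alpha>) * sin (\<theta> - \<beta>) < 0"
  assumes s: "sin (\<beta> - \<alpha>) \<noteq> 0" and S: "S \<subseteq> {0..<2 * pi}"
    and mem: "\<And>\<theta>. \<theta> \<in> {0..<2 * pi} \<Longrightarrow> sin (\<theta> - \<alpha>) \<noteq> 0 \<Longrightarrow> sin (\<theta> - \<beta>) \<noteq> 0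
      \<Longrightarrow> \<theta> \<in> S \<longleftrightarrow> R \<noteq> C \<theta>"
  shows "if R then measure lebesgue S > pi else measure lebesgue S < pi"
proof -
  define N where "N = {\<theta>. sin (\<theta> - \<alpha>) = 0} \<union> {\<theta>. sin (\<theta> - \<beta>) = 0}"
  define C' where "C' = {\<theta> \<in> {0..<2 * pi}. C \<theta>}"
  have N: "negligible N" unfolding N_def by (intro negligible_Un negligible_sin_zero)
  have C': "C' \<in> lmeasurable" "measure lebesgue C' < pi"
    using measure_sector_less_pi[OF s] by (auto simp: C'_def C_def)
  show ?thesis
  proof (cases R)
    case True
    let ?T = "{0..<2 * pi} - C'"
    have T: "?T \<in> lmeasurable" using C'
      by (intro fmeasurable.Diff bounded_set_imp_lmeasurable) auto
    have "(?T - S) \<union> (S - ?T) \<subseteq> N"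
      using mem True S by (auto simp: C'_def N_def)
    then have "measure lebesgue S = measure lebesgue ?T"
      using measure_negligible_symdiff[OF T] negligible_subset[OF N] by (metis sup_commute)
    also have "\<dots> = measure lebesgue {0..<2 * pi} - measure lebesgue C'"
      using C' by (intro measurable_measure_Diff) (auto simp: C'_def fmeasurable_def)
    also have "\<dots> > pi" using C' by simp
    finally show ?thesis using True by simp
  next
    case False
    have "(C' - S) \<union> (S - C') \<subseteq> N"
      using mem False S by (auto simp: C'_def N_def)
    then have "measure lebesgue S = measure lebesgue C'"
      using measure_negligible_symdiff[OF C'(1)] negligible_subset[OF N] by (metis sup_commute)
    then show ?thesis using C' False by simp
  qed
qed

section \<open>Interior angles\<close>

text \<open>In coordinates with vertex \<open>i\<close> at 0 and vertex \<open>j\<close> at 1, three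
  vertices are collinear exactly if the third coordinate is real.\<close>

lemma general_position_Im:
  assumes "general_position vs" "i < length vs" "j < length vs" "k < length vs"
    and "i \<noteq> j" "j \<noteq> k" "i \<noteq> k"
  shows "Im ((vs ! k - vs ! i) / (vs ! j - vs ! i)) \<noteq> 0"
proof
  assume "Im ((vs ! k - vs ! i) / (vs ! j - vs ! i)) = 0"
  then have "(vs ! k - vs ! i) / (vs ! j - vs ! i) \<in> \<real>" by (simp add: complex_is_Real_iff)
  then have "collinear {0, vs ! j - vs ! i, vs ! k - vs ! i}" by (simp add: collinear_iff_Reals)
  then have "collinear {vs ! j, vs ! i, vs ! k}" 
    using collinear_3[of "vs ! j" "vs ! i" "vs ! k"] by (simp add: NO_MATCH_def)
  then show False using assms by (auto simp: general_position_def)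
qed

lemma general_position_distinct:
  assumes "general_position vs" "length vs \<ge> 3" "i < length vs" "j < length vs" "i \<noteq> j"
  shows "vs ! i \<noteq> vs ! j"
proof
  assume e: "vs ! i = vs ! j"
  have "\<exists>k<3. k \<noteq> i \<and> k \<noteq> j" by presburger
  then obtain k where "k < 3" "k \<noteq> i" "k \<noteq> j" by blast
  with assms have "\<not> collinear {vs ! i, vs ! j, vs ! k}" by (auto simp: general_position_def)
  with e show False by simp
qed

lemma tail_ray_iff:
  assumes "x \<noteq> y"
  shows "w \<in> tail_ray x y \<longleftrightarrow> Im ((w - x) / (y - x)) = 0 \<and> Re ((w - x) / (y - x)) < 0"
proof
  assume "w \<in> tail_ray x y"
  then obtain t where "t < 0" "w = x + t *\<^sub>R (y - x)" by (auto simp: tail_ray_def)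
  moreover from this have "(w - x) / (y - x) = of_real t"
    using assms by (simp add: scaleR_conv_of_real)
  ultimately show "Im ((w - x) / (y - x)) = 0 \<and> Re ((w - x) / (y - x)) < 0"
    by (simp only: Im_complex_of_real Re_complex_of_real)
next
  assume r: "Im ((w - x) / (y - x)) = 0 \<and> Re ((w - x) / (y - x)) < 0"
  define t where "t = Re ((w - x) / (y - x))"
  have "(w - x) / (y - x) = of_real t"
    using r unfolding t_def by (simp only: complex_eq_iff Im_complex_of_real Re_complex_of_real)
  then have "w = x + t *\<^sub>R (y - x)"
    using assms by (simp add: scaleR_conv_of_real field_simps)
  then show "w \<in> tail_ray x y" using r by (auto simp: tail_ray_def t_def)
qed

lemma open_segment_meets_tail_ray_iff:
  assumes "x \<noteq> y" "Im ((p - x) / (y - x)) \<noteq> 0 \<or> Im ((q - x) / (y - x)) \<noteq> 0"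
  shows "open_segment p q \<inter> tail_ray x y \<noteq> {} \<longleftrightarrow>
         crosses_neg ((p - x) / (y - x)) ((q - x) / (y - x))"
proof -
  have "open_segment p q \<inter> tail_ray x y \<noteq> {} \<longleftrightarrow>
    (\<exists>w. (w - x) / (y - x) \<in> open_segment ((p - x) / (y - x)) ((q - x) / (y - x)) \<and>
      Im ((w - x) / (y - x)) = 0 \<and> Re ((w - x) / (y - x)) < 0)"
    using open_segment_scale[of "y - x" _ p q x] tail_ray_iff[OF assms(1)] assms(1) by auto
  also have "\<dots> \<longleftrightarrow> (\<exists>w\<in>open_segment ((p - x) / (y - x)) ((q - x) / (y - x)). Im w = 0 \<and> Re w < 0)"
  proof
    assume "\<exists>w\<in>open_segment ((p - x) / (y - x)) ((q - x) / (y - x)). Im w = 0 \<and> Re w < 0"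
    then obtain w where w: "w \<in> open_segment ((p - x) / (y - x)) ((q - x) / (y - x))" "Im w = 0" "Re w < 0"
      by blast
    have "((x + w * (y - x)) - x) / (y - x) = w" using assms(1) by simp
    with w show "\<exists>w. (w - x) / (y - x) \<in> open_segment ((p - x) / (y - x)) ((q - x) / (y - x)) \<and>
      Im ((w - x) / (y - x)) = 0 \<and> Re ((w - x) / (y - x)) < 0" by metis
  qed blast
  finally show ?thesis using open_segment_meets_neg_iff[OF assms(2)] by simp
qed

text \<open>Each alternative in \<open>st\<close> is an open condition that fixes the truth value of
  \<open>crosses_neg\<close>. The second alternative admits an edge with one end on the real axis,
  as needed for the edge leaving vertex \<open>i + 1\<close>, whose coordinate is 1.\<close>

lemma crosses_neg_stable:
  assumes f: "(f \<longlongrightarrow> p) F" and g: "(g \<longlongrightarrow> q) F"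
    and st: "Im p * Im q > 0 \<or> xprod p q * (Im q - Im p) > 0 \<or>
         Im p * Im q < 0 \<and> xprod p q * (Im q - Im p) \<noteq> 0"
  shows "\<forall>\<^sub>F r in F. (Im (f r) * Im (g r) > 0 \<or> xprod (f r) (g r) * (Im (g r) - Im (f r)) \<noteq> 0) \<and>
     (crosses_neg (f r) (g r) \<longleftrightarrow> crosses_neg p q)"
proof -
  have I: "((\<lambda>r. Im (f r) * Im (g r)) \<longlongrightarrow> Im p * Im q) F"
    by (intro tendsto_intros f g)
  have D: "((\<lambda>r. xprod (f r) (g r) * (Im (g r) - Im (f r))) \<longlongrightarrow> xprod p q * (Im q - Im p)) F"
    unfolding xprod_def by (intro tendsto_intros f g)
  consider "Im p * Im q > 0" | "xprod p q * (Im q - Im p) > 0"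
    | "Im p * Im q < 0" "xprod p q * (Im q - Im p) < 0"
    using st by linarith
  then show ?thesis
  proof cases
    case 1
    then show ?thesis using order_tendstoD(1)[OF I, of 0]
      by (auto simp: crosses_neg_def elim!: eventually_mono)
  next
    case 2
    then show ?thesis using order_tendstoD(1)[OF D, of 0]
      by (auto simp: crosses_neg_def elim!: eventually_mono)
  next
    case 3
    then show ?thesis using order_tendstoD(2)[OF D, of 0] order_tendstoD(2)[OF I, of 0]
      unfolding crosses_neg_def by (auto elim: eventually_elim2)
  qed
qed

section \<open>Cyclic labels and the edges counted by the tail\<close>

lemma Suc_mod_inj:
  "k < n \<Longrightarrow> l < n \<Longrightarrow> Suc k mod n = Suc l mod n \<Longrightarrow> k = l"
  by (auto simp: mod_Suc split: if_splits)

lemma Suc_mod_pred: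
  assumes "i < n" "2 < n"
  obtains h where "h < n" "Suc h mod n = i" "h \<noteq> i" "h \<noteq> Suc i mod n"
proof (cases i)
  case 0
  then show ?thesis using assms that[of "n - 1"] by auto
next
  case (Suc m)
  then show ?thesis using assms that[of m] by (auto simp: mod_Suc split: if_splits)
qed

lemma Suc_mod_neq:
  assumes "i < n" "2 < n"
  shows "Suc i mod n < n" "Suc i mod n \<noteq> i"
  using assms by (auto simp: mod_Suc split: if_splits)

lemma Suc_Suc_mod_neq:
  assumes "i < n" "2 < n"
  shows "Suc (Suc i mod n) mod n \<noteq> i"
  using assms by (cases "Suc i = n"; cases "Suc (Suc i) = n") auto

text \<open>The count skips only the edge from \<open>i\<close> to \<open>i + 1\<close>. The other
  edge at \<open>i\<close> has an end at coordinate 0, so \<open>crosses_neg\<close> is false for it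
  and it can be excluded as well. Any edge with \<open>k \<noteq> i\<close> has an end off the line,
  as \<open>open_segment_meets_tail_ray_iff\<close> requires.\<close>

lemma tail_edge_iff:
  assumes gp: "general_position vs" and n: "length vs \<ge> 3" and i: "i < length vs" and k: "k < length vs"
  shows "{k, Suc k mod length vs} \<noteq> {i, Suc i mod length vs} \<and>
      open_segment (vs ! k) (vs ! (Suc k mod length vs)) \<inter> tail_ray (vs ! i) (vs ! (Suc i mod length vs)) \<noteq> {}
    \<longleftrightarrow> k \<noteq> i \<and> Suc k mod length vs \<noteq> i \<and>
      crosses_neg ((vs ! k - vs ! i) / (vs ! (Suc i mod length vs) - vs ! i))
        ((vs ! (Suc k mod length vs) - vs ! i) / (vs ! (Suc i mod length vs) - vs ! i))"
proof -
  let ?n = "length vs"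
  let ?j = "Suc i mod ?n" and ?l = "Suc k mod ?n"
  let ?c = "\<lambda>k. (vs ! k - vs ! i) / (vs ! ?j - vs ! i)"
  have j: "?j < ?n" "?j \<noteq> i" using Suc_mod_neq[OF i] n by auto
  have l: "?l < ?n" "?l \<noteq> k" using Suc_mod_neq[OF k] n by auto
  have d: "vs ! i \<noteq> vs ! ?j" using general_position_distinct[OF gp n i j(1)] j(2) by simp
  show ?thesis
  proof (cases "k = i")
    case False
    have lj: "?l \<noteq> ?j" using Suc_mod_inj[OF k i] False by blast
    \<comment> \<open>With at least three vertices, the edge leaving \<open>i + 1\<close> does not
      return to \<open>i\<close>, so the skipped edge occurs only as \<open>k = i\<close>.\<close>
    have jl: "?l \<noteq> i" if "k = ?j"
      using Suc_Suc_mod_neq[OF i] n unfolding that by linarith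
    have edge: "{k, ?l} \<noteq> {i, ?j}" using False jl by (auto simp: doubleton_eq_iff)
    have "Im (?c k) \<noteq> 0 \<or> Im (?c ?l) \<noteq> 0"
    proof (cases "k = ?j")
      case True
      then show ?thesis using general_position_Im[OF gp i j(1) l(1)] j lj jl by auto
    next
      case False
      then show ?thesis using general_position_Im[OF gp i j(1) k] j \<open>k \<noteq> i\<close> by auto
    qed
    then have "open_segment (vs ! k) (vs ! ?l) \<inter> tail_ray (vs ! i) (vs ! ?j) \<noteq> {} \<longleftrightarrow>
        crosses_neg (?c k) (?c ?l)"
      by (rule open_segment_meets_tail_ray_iff[OF d])
    moreover have "\<not> crosses_neg (?c k) (?c ?l)" if "?l = i"
      unfolding that by (simp add: crosses_neg_def)
    ultimately show ?thesis using edge False by blast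
  qed simp
qed

text \<open>Cast a ray from the point at distance \<open>r\<close> in direction
  \<open>\<theta>\<close>, parallel to the tail ray. For small \<open>r\<close>, the edges away from
  \<open>i\<close> are crossed as by the tail ray itself, the edge from \<open>i\<close> to
  \<open>i + 1\<close> is parallel to the ray and not crossed, and the edge from \<open>h\<close> to
  \<open>i\<close> is crossed exactly if \<open>\<theta>\<close> lies in the open cone. The
  hypotheses \<open>sa\<close> and \<open>sb\<close> keep \<open>\<theta>\<close> off the lines of
  the two edges at \<open>i\<close>.\<close>

lemma interior_near_vertex:
  fixes vs :: "complex list" and i :: nat and \<theta> :: real
  defines "n \<equiv> length vs"
  defines "a \<equiv> vs ! (Suc i mod n) - vs ! i"
  assumes cs: "ccw_simple_polygon vs" and gp: "general_position vs" and i: "i < n"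
    and h: "h < n" "Suc h mod n = i"
    and bdef: "b = vs ! h - vs ! i"
    and sa: "sin (\<theta> - Arg a) \<noteq> 0" and sb: "sin (\<theta> - Arg b) \<noteq> 0"
  shows "sin (Arg b - Arg a) \<noteq> 0"
    and "(\<forall>\<^sub>F r in at_right 0. vs ! i + rcis r \<theta> \<in> polygon_interior vs) \<longleftrightarrow>
      odd (tail_count vs i (Suc i mod n)) \<noteq>
       (sin (Arg b - Arg a) * sin (\<theta> - Arg a) > 0 \<and> sin (Arg b - Arg a) * sin (\<theta> - Arg b) < 0)"
proof -
  let ?v = "vs ! i" and ?j = "Suc i mod n" and ?l = "\<lambda>k. Suc k mod n"
  \<comment> \<open>The direction of \<open>\<theta>\<close> in the coordinates \<open>c\<close>;
    moving the base point by \<open>r\<close> along it shifts every coordinate by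
    \<open>- r * \<epsilon>\<close>.\<close>
  define \<epsilon> where "\<epsilon> = cis \<theta> / a"
  define c where "c = (\<lambda>k. (vs ! k - ?v) / a)"
  define CC where "CC \<longleftrightarrow> sin (Arg b - Arg a) * sin (\<theta> - Arg a) > 0 \<and>
      sin (Arg b - Arg a) * sin (\<theta> - Arg b) < 0"
  have n: "n \<ge> 3" using cs by (simp add: ccw_simple_polygon_def n_def)
  have j: "?j < n" "?j \<noteq> i" using Suc_mod_neq[OF i] n by auto
  have hi: "h \<noteq> i" using Suc_mod_neq[OF h(1)] n h(2) by auto
  have hj: "h \<noteq> ?j"
  proof
    assume "h = ?j"
    then have "Suc (Suc i mod n) mod n = i" using h by simp
    then show False using Suc_Suc_mod_neq[OF i] n by simp
  qed
  have a0: "a \<noteq> 0" and b0: "b \<noteq> 0"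
    using general_position_distinct[OF gp _ _ _ j(2)] general_position_distinct[OF gp _ _ _ hi] n i j h
    by (auto simp: a_def bdef n_def)
  have Imc: "Im (c k) \<noteq> 0" if "k < n" "k \<noteq> i" "k \<noteq> ?j" for k
    using general_position_Im[OF gp, of i ?j k] that i j unfolding c_def a_def n_def by auto
  have ci: "c i = 0" and cj: "c ?j = 1" using a0 by (auto simp: c_def a_def)
  have apol: "a = of_real (cmod a) * cis (Arg a)" and bpol: "b = of_real (cmod b) * cis (Arg b)"
    using rcis_cmod_Arg[of a] rcis_cmod_Arg[of b] by (simp_all add: rcis_def)
  have na: "cmod a > 0" and nb: "cmod b > 0" using a0 b0 by auto
  have eps: "\<epsilon> = of_real (1 / cmod a) * cis (\<theta> - Arg a)"
  proof -
    have "\<epsilon> = cis \<theta> / (of_real (cmod a) * cis (Arg a))" unfolding \<epsilon>_def by (subst apol) (rule refl)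
    then show ?thesis by (simp add: cis_divide[symmetric])
  qed
  have ch: "c h = of_real (cmod b / cmod a) * cis (Arg b - Arg a)"
  proof -
    have "c h = b / a" by (simp add: c_def bdef)
    also have "\<dots> = (of_real (cmod b) * cis (Arg b)) / (of_real (cmod a) * cis (Arg a))"
      using apol bpol by simp
    finally show ?thesis by (simp add: cis_divide[symmetric])
  qed
  have Ime: "Im \<epsilon> = sin (\<theta> - Arg a) / cmod a" by (simp add: eps)
  have Imh: "Im (c h) = cmod b / cmod a * sin (Arg b - Arg a)" by (simp add: ch)
  have xhe: "xprod (c h) \<epsilon> = cmod b / (cmod a)\<^sup>2 * sin (\<theta> - Arg b)"
  proof -
    have "sin (\<theta> - Arg b) = sin ((\<theta> - Arg a) - (Arg b - Arg a))" by simp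
    also have "\<dots> = sin (\<theta> - Arg a) * cos (Arg b - Arg a) - cos (\<theta> - Arg a) * sin (Arg b - Arg a)"
      by (rule sin_diff)
    finally have s: "sin (\<theta> - Arg b) = \<dots>" .
    show ?thesis
      unfolding s using na by (simp add: xprod_def ch eps power2_eq_square field_simps)
  qed
  have e0: "Im \<epsilon> \<noteq> 0" using sa na by (simp add: Ime)
  show sba: "sin (Arg b - Arg a) \<noteq> 0"
    using Imc[OF h(1) hi hj] by (simp add: Imh)
  have CC: "CC \<longleftrightarrow> Im (c h) * Im \<epsilon> > 0 \<and> Im (c h) * xprod (c h) \<epsilon> < 0"
  proof -
    have "Im (c h) * Im \<epsilon> = (cmod b / (cmod a)\<^sup>2) * (sin (Arg b - Arg a) * sin (\<theta> - Arg a))"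
      by (simp add: Imh Ime power2_eq_square)
    moreover have "Im (c h) * xprod (c h) \<epsilon> = ((cmod b)\<^sup>2 / (cmod a)^3) * (sin (Arg b - Arg a) * sin (\<theta> - Arg b))"
      using na by (simp add: Imh xhe power2_eq_square power3_eq_cube field_simps)
    ultimately show ?thesis using na nb
      by (simp add: CC_def zero_less_mult_iff mult_less_0_iff zero_less_divide_iff divide_less_0_iff)
  qed
  define C where "C = (\<lambda>r k. (vs ! k - (?v + rcis r \<theta>)) / a)"
  have C: "C r k = c k - of_real r * \<epsilon>" for r k
    by (simp add: C_def c_def \<epsilon>_def rcis_def diff_divide_distrib add_divide_distrib)
  have lim: "((\<lambda>r. C r k) \<longlongrightarrow> c k) (at_right 0)" for k
  proof -
    have "((\<lambda>r. c k - of_real r * \<epsilon>) \<longlongrightarrow> c k - of_real 0 * \<epsilon>) (at_right 0)"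
      by (intro tendsto_intros)
    then show ?thesis by (simp add: C)
  qed
  have pos: "\<forall>\<^sub>F r in at_right 0. r > (0::real)" by (rule eventually_at_right_less)
  have Im: "\<forall>\<^sub>F r in at_right 0. Im (C r k) \<noteq> 0" for k
  proof (cases "Im (c k) = 0")
    case True
    show ?thesis by (rule eventually_mono[OF pos]) (use True e0 in \<open>simp add: C\<close>)
  next
    case False
    then show ?thesis using tendsto_imp_eventually_ne[OF tendsto_Im[OF lim[of k]]] by blast
  qed
  \<comment> \<open>The crossing status of edge \<open>k\<close> for small positive
    \<open>r\<close>; for \<open>k = i\<close> it is false.\<close>
  define E where "E = (\<lambda>k. if k = h then CC else k \<noteq> i \<and> crosses_neg (c k) (c (?l k)))"
  have edge: "\<forall>\<^sub>F r in at_right 0.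
      (Im (C r k) * Im (C r (?l k)) > 0 \<or>
        xprod (C r k) (C r (?l k)) * (Im (C r (?l k)) - Im (C r k)) \<noteq> 0) \<and>
      (crosses_neg (C r k) (C r (?l k)) \<longleftrightarrow> E k)" if k: "k < n" for k
  proof -
    consider "k = h" | "k = i" | "k \<noteq> h" "k \<noteq> i" by blast
    then show ?thesis
    proof cases
      case 1
      \<comment> \<open>An exact identity for every \<open>r\<close>, so for \<open>r > 0\<close>
        the sign does not depend on \<open>r\<close>. Only the factor \<open>Im (C r h)\<close>
        needs a limit.\<close>
      have D: "xprod (C r h) (C r i) * (Im (C r i) - Im (C r h)) = r * (Im (c h) * xprod (c h) \<epsilon>)" for r
        by (simp add: C ci xprod_def algebra_simps)
      have nz: "Im (c h) * xprod (c h) \<epsilon> \<noteq> 0"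
        using sba sb na nb by (simp add: Imh xhe)
      have lim': "((\<lambda>r. Im (C r h) * Im \<epsilon>) \<longlongrightarrow> Im (c h) * Im \<epsilon>) (at_right 0)"
        by (intro tendsto_intros lim)
      have ne: "Im (c h) * Im \<epsilon> \<noteq> 0" using sba sa na nb by (simp add: Imh Ime)
      have I: "Im (C r h) * Im (C r i) = - r * (Im (C r h) * Im \<epsilon>)" for r
        by (simp add: C ci)
      have sg: "\<forall>\<^sub>F r in at_right 0. Im (C r h) * Im \<epsilon> > 0 \<longleftrightarrow> Im (c h) * Im \<epsilon> > 0"
      proof (cases "Im (c h) * Im \<epsilon> > 0")
        case True
        then show ?thesis using order_tendstoD(1)[OF lim'] by (auto elim!: eventually_mono)
      next
        case False
        then show ?thesis using order_tendstoD(2)[OF lim', of 0] ne by (auto elim!: eventually_mono)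
      qed
      from sg pos show ?thesis
      proof eventually_elim
        case (elim r)
        have sgn: "- r * x < 0 \<longleftrightarrow> x > 0" "r * x < 0 \<longleftrightarrow> x < 0" for x
          using elim(2) by (simp_all add: zero_less_mult_iff mult_less_0_iff)
        have "crosses_neg (C r h) (C r i) \<longleftrightarrow> Im (C r h) * Im \<epsilon> > 0 \<and> Im (c h) * xprod (c h) \<epsilon> < 0"
          unfolding crosses_neg_def I D sgn ..
        then show ?case
          using elim nz unfolding 1 h(2) D by (simp add: E_def CC)
      qed
    next
      case 2
      show ?thesis using pos
      proof eventually_elim
        case (elim r)
        \<comment> \<open>Both ends have imaginary part \<open>- r * Im \<epsilon>\<close>, so the
          product is a positive square.\<close>
        have "Im (C r i) * Im (C r ?j) > 0"
          using mult_pos_pos[OF mult_pos_pos[OF elim elim] zero_less_power2[of "Im \<epsilon>", THEN iffD2, OF e0]]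
          by (simp add: C ci cj power2_eq_square mult_ac)
        then show ?case using hi unfolding 2 by (auto simp: E_def crosses_neg_def)
      qed
    next
      case 3
      have li: "?l k \<noteq> i" using Suc_mod_inj[OF k h(1)] 3 h(2) by auto
      have lj: "?l k \<noteq> ?j" using Suc_mod_inj[OF k i] 3 by auto
      have l: "?l k < n" "?l k \<noteq> k" using Suc_mod_neq[OF k] n by auto
      have Iml: "Im (c (?l k)) \<noteq> 0" using Imc[OF l(1) li lj] .
      have x0: "xprod (c k) (c (?l k)) \<noteq> 0"
      proof -
        have "Im ((vs ! ?l k - ?v) / (vs ! k - ?v)) \<noteq> 0"
          using general_position_Im[OF gp, of i k "?l k"] i k l li 3 by (auto simp: n_def)
        also have "(vs ! ?l k - ?v) / (vs ! k - ?v) = c (?l k) / c k"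
          using a0 by (simp add: c_def)
        finally show ?thesis
          by (auto simp: Im_divide xprod_def algebra_simps)
      qed
      have "Im (c k) * Im (c (?l k)) > 0 \<or> xprod (c k) (c (?l k)) * (Im (c (?l k)) - Im (c k)) > 0 \<or>
         Im (c k) * Im (c (?l k)) < 0 \<and> xprod (c k) (c (?l k)) * (Im (c (?l k)) - Im (c k)) \<noteq> 0"
      proof (cases "k = ?j")
        case True
        have "xprod (c ?j) (c (?l ?j)) * (Im (c (?l ?j)) - Im (c ?j)) = (Im (c (?l ?j)))\<^sup>2"
          unfolding cj by (simp add: xprod_def power2_eq_square)
        then show ?thesis using Iml True by simp
      next
        case False
        then have "Im (c k) \<noteq> 0" using Imc[OF k] 3 by blast
        then show ?thesis using Iml x0
          by (cases "Im (c k) * Im (c (?l k))" "0::real" rule: linorder_cases)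
             (auto simp: mult_less_0_iff)
      qed
      from crosses_neg_stable[OF lim lim this] show ?thesis using 3 by (simp add: E_def)
    qed
  qed
  have "\<forall>\<^sub>F r in at_right 0. \<forall>k\<in>{..<n}. Im (C r k) \<noteq> 0 \<and>
      (Im (C r k) * Im (C r (?l k)) > 0 \<or>
        xprod (C r k) (C r (?l k)) * (Im (C r (?l k)) - Im (C r k)) \<noteq> 0) \<and>
      (crosses_neg (C r k) (C r (?l k)) \<longleftrightarrow> E k)"
    by (intro eventually_ball_finite ballI eventually_conj Im edge) auto
  then have "\<forall>\<^sub>F r in at_right 0. ?v + rcis r \<theta> \<in> polygon_interior vs \<longleftrightarrow> odd (card {k. k < n \<and> E k})"
  proof eventually_elim
    case (elim r)
    have "{k. k < n \<and> crosses_neg (C r k) (C r (?l k))} = {k. k < n \<and> E k}" using elim by auto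
    moreover have "?v + rcis r \<theta> \<in> polygon_interior vs \<longleftrightarrow>
        odd (card {k. k < n \<and> crosses_neg (C r k) (C r (?l k))})"
      unfolding C_def n_def
      by (rule interior_iff_odd_crossings[OF cs a0]) (use elim in \<open>auto simp: C_def n_def\<close>)
    ultimately show ?case by simp
  qed
  then have ev: "(\<forall>\<^sub>F r in at_right 0. ?v + rcis r \<theta> \<in> polygon_interior vs) \<longleftrightarrow>
      (\<forall>\<^sub>F r in at_right (0::real). odd (card {k. k < n \<and> E k}))"
    by (rule eventually_cong)
  define T where "T = {k. k < n \<and> {k, ?l k} \<noteq> {i, ?j} \<and>
      open_segment (vs ! k) (vs ! ?l k) \<inter> tail_ray ?v (vs ! ?j) \<noteq> {}}"
  have T: "k \<in> T \<longleftrightarrow> k < n \<and> k \<noteq> i \<and> k \<noteq> h \<and> crosses_neg (c k) (c (?l k))" for k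
    using tail_edge_iff[OF gp, of i k] n i h Suc_mod_inj[of k n h]
    unfolding T_def n_def c_def a_def by auto
  have fT: "finite T" unfolding T_def by auto
  \<comment> \<open>Edge \<open>h\<close> joins the tail edges exactly inside the cone, which flips
    the parity there.\<close>
  have "{k. k < n \<and> E k} = T \<union> (if CC then {h} else {})"
    using T h(1) hi by (auto simp: E_def)
  moreover have "h \<notin> T" using T by auto
  ultimately have "odd (card {k. k < n \<and> E k}) \<longleftrightarrow> odd (card T) \<noteq> CC"
    using fT by auto
  moreover have "card T = tail_count vs i ?j"
    by (simp add: T_def tail_count_def crossings_def n_def)
  ultimately show "(\<forall>\<^sub>F r in at_right 0. ?v + rcis r \<theta> \<in> polygon_interior vs) \<longleftrightarrow>
      odd (tail_count vs i ?j) \<noteq>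
       (sin (Arg b - Arg a) * sin (\<theta> - Arg a) > 0 \<and> sin (Arg b - Arg a) * sin (\<theta> - Arg b) < 0)"
    using ev by (simp add: CC_def)
qed

text \<open>An even tail count leaves the open cone of the two edges at \<open>i\<close> as interior
  directions, an odd one the complementary sector, up to a null set.\<close>

lemma interior_angle_tail_parity:
  assumes cs: "ccw_simple_polygon vs" and gp: "general_position vs" and i: "i < length vs"
  shows "if odd (tail_count vs i (Suc i mod length vs)) then interior_angle vs i > pi
    else interior_angle vs i < pi"
proof -
  let ?n = "length vs"
  have n: "2 < ?n" using cs by (simp add: ccw_simple_polygon_def)
  obtain h where h: "h < ?n" "Suc h mod ?n = i" using Suc_mod_pred[OF i n] by blast
  define a where "a = vs ! (Suc i mod ?n) - vs ! i"
  define b where "b = vs ! h - vs ! i"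
  \<comment> \<open>Any direction off the two edge lines; it serves to obtain
    \<open>sin (Arg b - Arg a) \<noteq> 0\<close> from \<open>near(1)\<close>.\<close>
  obtain \<theta> where t: "sin (\<theta> - Arg a) \<noteq> 0" "sin (\<theta> - Arg b) \<noteq> 0"
  proof -
    have "negligible ({\<theta>. sin (\<theta> - Arg a) = 0} \<union> {\<theta>. sin (\<theta> - Arg b) = 0})"
      by (intro negligible_Un negligible_sin_zero)
    then have "{\<theta>. sin (\<theta> - Arg a) = 0} \<union> {\<theta>. sin (\<theta> - Arg b) = 0} \<noteq> UNIV"
      using non_negligible_UNIV by metis
    then show ?thesis using that by auto
  qed
  note near = interior_near_vertex[OF cs gp i h b_def, folded a_def]
  show ?thesis
    unfolding interior_angle_def
    by (rule measure_compare_sector[OF near(1)[OF t]]) (use near(2) in auto)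
qed

section \<open>Hull vertices\<close>

text \<open>The boundary lies in the hull of the vertices, and a point off a convex bounded set is
  outside it, hence outside the boundary. So hull vertices are extreme points of the hull of a
  finite set.\<close>

lemma convex_hull_polygon_region:
  assumes "vs \<noteq> []"
  shows "convex hull (polygon_region vs) = convex hull (set vs)"
proof
  let ?\<gamma> = "path_image (boundary_path vs)"
  have sub: "?\<gamma> \<subseteq> convex hull (set vs)"
    unfolding path_image_boundary[OF assms]
    using assms by (intro UN_least closed_segment_subset_convex_hull hull_inc) auto
  have "polygon_interior vs \<subseteq> convex hull (set vs)"
  proof
    fix z assume z: "z \<in> polygon_interior vs"
    show "z \<in> convex hull (set vs)"
    proof (rule ccontr)
      assume "z \<notin> convex hull (set vs)"
      then have "z \<in> outside (convex hull (set vs))" by (intro convex_in_outside) auto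
      then have "z \<in> outside ?\<gamma>" using outside_mono[OF sub] by blast
      then show False using z inside_Int_outside[of ?\<gamma>] unfolding polygon_interior_def by blast
    qed
  qed
  then show "convex hull (polygon_region vs) \<subseteq> convex hull (set vs)"
    using sub by (intro hull_minimal) (auto simp: polygon_region_def)
  have "set vs \<subseteq> polygon_region vs"
  proof
    fix x assume "x \<in> set vs"
    then obtain k where "k < length vs" "x = vs ! k" by (metis in_set_conv_nth)
    then show "x \<in> polygon_region vs"
      unfolding polygon_region_def path_image_boundary[OF assms] by auto
  qed
  then show "convex hull (set vs) \<subseteq> convex hull (polygon_region vs)"
    by (rule hull_mono)
qed

lemma crossings_eq_0_iff:
  "crossings vs i j R = 0 \<longleftrightarrow> (\<forall>k<length vs. {k, Suc k mod length vs} \<noteq> {i, j} \<longrightarrow>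
     open_segment (vs ! k) (vs ! (Suc k mod length vs)) \<inter> R = {})"
  by (auto simp: crossings_def)

text \<open>An edge point on the tail ray belongs to the hull, and vertex \<open>i\<close> would lie
  strictly between it and vertex \<open>j\<close>, against extremality.\<close>

lemma hull_vertex_tail_zero:
  assumes hv: "hull_vertex vs i" and gp: "general_position vs" and n: "length vs \<ge> 3"
    and i: "i < length vs" and j: "j < length vs" "j \<noteq> i"
  shows "tail_count vs i j = 0"
  unfolding tail_count_def crossings_eq_0_iff
proof (intro allI impI)
  fix k assume k: "k < length vs"
  let ?H = "convex hull (set vs)"
  have ne: "vs \<noteq> []" using i by auto
  have ext: "(vs ! i) extreme_point_of ?H"
    using hv by (simp add: hull_vertex_def convex_hull_polygon_region[OF ne])
  have d: "vs ! i \<noteq> vs ! j" using general_position_distinct[OF gp n i j(1)] j(2) by simp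
  have V: "vs ! l \<in> ?H" if "l < length vs" for l using that by (simp add: hull_inc)
  show "open_segment (vs ! k) (vs ! (Suc k mod length vs)) \<inter> tail_ray (vs ! i) (vs ! j) = {}"
  proof (rule ccontr)
    assume "\<not> ?thesis"
    then obtain w t where w: "w \<in> open_segment (vs ! k) (vs ! (Suc k mod length vs))"
      and t: "t < 0" "w = vs ! i + t *\<^sub>R (vs ! j - vs ! i)" by (auto simp: tail_ray_def)
    have "closed_segment (vs ! k) (vs ! (Suc k mod length vs)) \<subseteq> ?H"
      using V k ne by (intro closed_segment_subset) auto
    then have "w \<in> ?H" using w by (auto simp: open_segment_def)
    moreover have "vs ! i \<in> open_segment w (vs ! j)"
    proof -
      \<comment> \<open>The solution of \<open>(1 - u) * t + u = 0\<close>, as \<open>w\<close> and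
        vertex \<open>j\<close> have parameters \<open>t\<close> and 1 on the line and vertex
        \<open>i\<close> has 0.\<close>
      define u where "u = - t / (1 - t)"
      have u: "0 < u" "u < 1" using t by (auto simp: u_def field_simps)
      have ut: "(1 - u) * (1 - t) = 1" using t by (simp add: u_def field_simps)
      have w': "w = (1 - t) *\<^sub>R (vs ! i) + t *\<^sub>R (vs ! j)" by (simp add: t algebra_simps)
      have "(1 - u) *\<^sub>R w + u *\<^sub>R (vs ! j)
          = ((1 - u) * (1 - t)) *\<^sub>R (vs ! i) + ((1 - u) * t + u) *\<^sub>R (vs ! j)"
        unfolding w' by (simp add: scaleR_add_left scaleR_add_right)
      also have "(1 - u) * t + u = 0" using ut by (simp add: algebra_simps)
      finally have e: "vs ! i = (1 - u) *\<^sub>R w + u *\<^sub>R (vs ! j)" using ut by simp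
      have "w \<noteq> vs ! j"
      proof
        assume "w = vs ! j"
        then have "(1 - t) *\<^sub>R (vs ! j - vs ! i) = 0" using t by (simp add: algebra_simps)
        then show False using t d by simp
      qed
      then show ?thesis using u e by (auto simp: in_segment)
    qed
    ultimately show False using ext V[OF j(1)] by (auto simp: extreme_point_of_def)
  qed
qed

text \<open>\<open>A\<close> is the polar angle seen from vertex \<open>i\<close>, with vertex
  \<open>i + 1\<close> at angle 0, and \<open>p\<close> attains its maximum. Following the boundary
  from \<open>i + 1\<close> around to the predecessor of \<open>i\<close>, the angle can neither
  jump at the cut, which is the tail ray of \<open>(i, i + 1)\<close>, nor fall to
  \<open>A p - pi\<close>, the direction of the tail ray of \<open>(i, p)\<close>. So all angles lie
  within less than \<open>pi\<close> of each other.\<close>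

lemma tail_zero_hull_vertex:
  assumes gp: "general_position vs" and n: "length vs \<ge> 3" and i: "i < length vs"
    and z: "\<And>j. j < length vs \<Longrightarrow> j \<noteq> i \<Longrightarrow> tail_count vs i j = 0"
  shows "hull_vertex vs i"
proof -
  let ?n = "length vs" and ?v = "vs ! i"
  let ?j = "Suc i mod ?n"
  define a where "a = vs ! ?j - ?v"
  define c where "c = (\<lambda>k. (vs ! k - ?v) / a)"
  define A where "A = (\<lambda>k. Arg (c k))"
  define J where "J = {..<?n} - {i}"
  have j: "?j < ?n" "?j \<noteq> i" using Suc_mod_neq[OF i] n by auto
  have ne: "vs ! k \<noteq> ?v" if "k \<in> J" for k
    using general_position_distinct[OF gp n _ i] that by (auto simp: J_def)
  have a0: "a \<noteq> 0" using ne[of ?j] j by (auto simp: a_def J_def)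
  have c0: "c k \<noteq> 0" if "k \<in> J" for k using ne[OF that] a0 by (simp add: c_def)
  have jJ: "?j \<in> J" using j by (simp add: J_def)
  have Aj: "A ?j = 0" using a0 by (simp add: A_def c_def a_def)
  have fJ: "finite J" "J \<noteq> {}" using jJ by (auto simp: J_def)
  obtain p where p: "p \<in> J" "\<And>k. k \<in> J \<Longrightarrow> A k \<le> A p"
    using obtains_MAX[OF fJ, of A] by (metis Max_ge finite_imageI fJ(1) imageI)
  obtain q where q: "q \<in> J" "\<And>k. k \<in> J \<Longrightarrow> A q \<le> A k"
    using obtains_MIN[OF fJ, of A] by (metis Min_le finite_imageI fJ(1) imageI)
  have Ap: "0 \<le> A p" "A p \<le> pi" using p(2)[OF jJ] Aj Arg_bounded[of "c p"] by (auto simp: A_def)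
  have tail: "w \<notin> tail_ray ?v (vs ! k)"
    if "k \<in> J" "l \<in> J" "Suc l mod ?n \<in> J" "w \<in> open_segment (vs ! l) (vs ! (Suc l mod ?n))" for k l w
  proof -
    have "l \<noteq> i" "Suc l mod ?n \<noteq> i" and l: "l < ?n" and k: "k < ?n" "k \<noteq> i"
      using that(1-3) unfolding J_def by auto
    then have "{l, Suc l mod ?n} \<noteq> {i, k}" by (auto simp only: doubleton_eq_iff)
    from z[OF k, unfolded tail_count_def crossings_eq_0_iff, rule_format, OF l this] that(4)
    show ?thesis by blast
  qed
  have opp: "w \<in> tail_ray ?v (vs ! p)"
    if w: "w \<noteq> ?v" "Arg ((w - ?v) / a) = A p - pi" for w
  proof -
    have w0: "(w - ?v) / a \<noteq> 0" using w a0 by simp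
    define y where "y = cmod ((w - ?v) / a)"
    have e1: "(w - ?v) / a = of_real y * cis (A p - pi)"
      using rcis_cmod_Arg[of "(w - ?v) / a"] w(2) unfolding y_def by (simp only: rcis_def)
    have e2: "c p = of_real (cmod (c p)) * cis (A p)"
      using rcis_cmod_Arg[of "c p"] by (simp only: rcis_def A_def)
    have cp: "cmod (c p) > 0" using c0[OF p(1)] by simp
    have "cis (A p - pi) = - cis (A p)" by (simp add: complex_eq_iff)
    also have "cis (A p) = c p / of_real (cmod (c p))"
      using cp by (subst e2) simp
    finally have "(w - ?v) / a = of_real (- (y / cmod (c p))) * c p"
      using e1 by simp
    then have "(w - ?v) / a * a = of_real (- (y / cmod (c p))) * (c p * a)"
      by (simp only: mult.assoc)
    moreover have "c p * a = vs ! p - ?v" "(w - ?v) / a * a = w - ?v"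
      using a0 by (simp_all add: c_def)
    ultimately have "w - ?v = of_real (- (y / cmod (c p))) * (vs ! p - ?v)" by (simp only:)
    then have "w = ?v + (- (y / cmod (c p))) *\<^sub>R (vs ! p - ?v)"
      by (simp only: scaleR_conv_of_real diff_eq_eq add.commute)
    moreover have "- (y / cmod (c p)) < 0" using w0 cp by (simp add: y_def)
    ultimately show ?thesis unfolding tail_ray_def by blast
  qed
  have step: "A (Suc k mod ?n) > A p - pi"
    if k: "k \<in> J" "Suc k mod ?n \<in> J" and Ak: "A k > A p - pi" for k
  proof (rule ccontr)
    let ?l = "Suc k mod ?n"
    assume "\<not> A ?l > A p - pi"
    then have le: "A ?l \<le> A p - pi" by simp
    have kl: "k \<noteq> ?l" using Suc_mod_neq[of k ?n] k n by (auto simp: J_def)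
    define f where "f = (\<lambda>t. Arg ((linepath (vs ! k) (vs ! ?l) t - ?v) / a))"
    \<comment> \<open>The edge avoids the cut, so that \<open>Arg\<close> is continuous along it:
      vertex \<open>i\<close> is off the edge by general position, no end has a nonpositive real
      coordinate, and an inner point on the cut would be counted by the tail of
      \<open>(i, i + 1)\<close>.\<close>
    have off: "(linepath (vs ! k) (vs ! ?l) t - ?v) / a \<notin> \<real>\<^sub>\<le>\<^sub>0" if t: "0 \<le> t" "t \<le> 1" for t
    proof
      let ?w = "linepath (vs ! k) (vs ! ?l) t"
      assume neg: "(?w - ?v) / a \<in> \<real>\<^sub>\<le>\<^sub>0"
      have wseg: "?w \<in> closed_segment (vs ! k) (vs ! ?l)"
        using t linepath_in_path[of t] by auto
      have wv: "?w \<noteq> ?v"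
      proof
        assume "?w = ?v"
        then have "collinear {vs ! k, ?v, vs ! ?l}"
          using wseg by (metis between_mem_segment between_imp_collinear)
        then show False using gp k i kl by (auto simp: general_position_def J_def)
      qed
      have "?w \<noteq> vs ! m" if m: "m \<in> J" for m
      proof
        assume wm: "?w = vs ! m"
        have nr: "c m \<in> \<real>\<^sub>\<le>\<^sub>0" using neg unfolding wm c_def .
        show False
        proof (cases "m = ?j")
          case True
          then show False using nr a0 by (simp add: c_def a_def)
        next
          case False
          have "Im (c m) \<noteq> 0"
            using general_position_Im[OF gp i j(1), of m] False j m unfolding c_def a_def J_def by auto
          then show False using nr by (simp add: complex_nonpos_Reals_iff)
        qed
      qed
      then have "?w \<in> open_segment (vs ! k) (vs ! ?l)"
        using wseg k by (auto simp: open_segment_def)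
      then have "?w \<notin> tail_ray ?v (vs ! ?j)" using tail[OF jJ k] by blast
      moreover have "?w \<in> tail_ray ?v (vs ! ?j)"
      proof -
        have "(?w - ?v) / a \<noteq> 0" using wv a0 by simp
        then have "Im ((?w - ?v) / a) = 0" "Re ((?w - ?v) / a) < 0"
          using neg unfolding complex_nonpos_Reals_iff by (auto simp: complex_eq_iff less_le)
        then show ?thesis using tail_ray_iff[of ?v "vs ! ?j"] ne[OF jJ] unfolding a_def by metis
      qed
      ultimately show False by blast
    qed
    have "continuous_on {0..1} f"
      unfolding f_def
      using a0 off by (intro continuous_on_Arg' continuous_intros) auto
    moreover have "f 0 = A k" "f 1 = A ?l" by (simp_all add: f_def A_def c_def linepath_0' linepath_1')
    ultimately obtain t where t: "0 \<le> t" "t \<le> 1" "f t = A p - pi"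
      using IVT2'[of f 1 "A p - pi" 0] le Ak by auto
    let ?w = "linepath (vs ! k) (vs ! ?l) t"
    have wv: "?w \<noteq> ?v" using off[OF t(1,2)] by auto
    have tr: "?w \<in> tail_ray ?v (vs ! p)" using opp[OF wv] t(3) by (simp add: f_def)
    \<comment> \<open>The crossing must be at an inner point of the edge to contradict the tail
      count. The strict bound on \<open>A k\<close> rules out \<open>t = 0\<close>, general position
      rules out \<open>t = 1\<close>.\<close>
    have "t \<noteq> 0" using t Ak \<open>f 0 = A k\<close> by auto
    have "t \<noteq> 1"
    proof
      assume "t = 1"
      then have w1: "?w = vs ! ?l" by (simp add: linepath_1')
      have nv: "?v \<noteq> vs ! p" using ne[OF p(1)] by simp
      have r: "Im ((vs ! ?l - ?v) / (vs ! p - ?v)) = 0" "Re ((vs ! ?l - ?v) / (vs ! p - ?v)) < 0"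
        using tr tail_ray_iff[OF nv] unfolding w1 by auto
      have "?l \<noteq> p"
      proof
        assume "?l = p"
        then have "(vs ! ?l - ?v) / (vs ! p - ?v) = 1" using nv by simp
        then show False using r(2) by (simp only: one_complex.sel) 
      qed
      then show False
        using r(1) general_position_Im[OF gp i, of p ?l] p(1) k by (auto simp: J_def)
    qed
    have "vs ! k \<noteq> vs ! ?l"
      using general_position_distinct[OF gp n _ _ kl] k by (auto simp: J_def)
    then have "?w \<in> open_segment (vs ! k) (vs ! ?l)"
      using t \<open>t \<noteq> 0\<close> \<open>t \<noteq> 1\<close> unfolding in_segment linepath_def by (auto intro!: exI[of _ t])
    then show False using tail[OF p(1) k] tr by blast
  qed
  \<comment> \<open>The bound \<open>Suc s < ?n\<close> stops the walk along the labels just before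
    it returns to \<open>i\<close>.\<close>
  have gt: "A ((i + Suc s) mod ?n) > A p - pi" if "Suc s < ?n" for s
    using that
  proof (induction s)
    case 0
    \<comment> \<open>Angle \<open>pi\<close> would put vertex \<open>p\<close> on the line through
      \<open>i\<close> and \<open>i + 1\<close>. This makes the start of the walk strict.\<close>
    have "A p \<noteq> pi"
    proof
      assume Api: "A p = pi"
      then have "p \<noteq> ?j" using Aj by auto
      then have "Im (c p) \<noteq> 0"
        using general_position_Im[OF gp i j(1), of p] j p(1) unfolding c_def a_def J_def by auto
      then show False using Api Arg_eq_pi[of "c p"] by (simp add: A_def)
    qed
    then show ?case using Aj Ap by simp
  next
    case (Suc s)
    have m: "(i + Suc t) mod ?n \<in> J" if "Suc t < ?n" for t
    proof -
      have "(i + Suc t) mod ?n \<noteq> i"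
        using that i by (cases "i + Suc t < ?n") (auto simp: mod_if)
      moreover have "(i + Suc t) mod ?n < ?n" using i by (intro mod_less_divisor) auto
      ultimately show ?thesis unfolding J_def by blast
    qed
    have "Suc ((i + Suc s) mod ?n) mod ?n = (i + Suc (Suc s)) mod ?n"
      by (simp add: mod_Suc_eq)
    then show ?case
      using step[of "(i + Suc s) mod ?n"] m[of s] m[of "Suc s"] Suc by simp
  qed
  have all: "A k > A p - pi" if k: "k \<in> J" for k
  proof (cases "i < k")
    case True
    then show ?thesis using gt[of "k - i - 1"] k by (auto simp: J_def)
  next
    case False
    then have "k < i" using k by (auto simp: J_def)
    moreover have "i + Suc (k + ?n - i - 1) = k + ?n" using i by simp
    then have "(i + Suc (k + ?n - i - 1)) mod ?n = k"
      using \<open>k < i\<close> i by simp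
    ultimately show ?thesis using gt[of "k + ?n - i - 1"] i by simp
  qed
  \<comment> \<open>The middle between the extreme angles, which differ by less than
    \<open>pi\<close>; every other vertex is then seen within a right angle of it.\<close>
  define \<phi> where "\<phi> = (A p + A q) / 2"
  have half: "Re (cis (- \<phi>) * c k) > 0" if k: "k \<in> J" for k
  proof -
    have "\<bar>A k - \<phi>\<bar> < pi / 2"
      using p(2)[OF k] q(2)[OF k] all[OF q(1)] unfolding \<phi>_def by (simp add: abs_if field_simps)
    then have cpos: "cos (A k - \<phi>) > 0" by (intro cos_gt_zero_pi) (auto simp: abs_if split: if_splits)
    have e: "c k = of_real (cmod (c k)) * cis (A k)"
      using rcis_cmod_Arg[of "c k"] by (simp only: rcis_def A_def)
    have "cis (- \<phi>) * c k = of_real (cmod (c k)) * cis (A k - \<phi>)"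
      by (subst e) (simp add: cis_mult mult.left_commute)
    then have "Re (cis (- \<phi>) * c k) = cmod (c k) * cos (A k - \<phi>)" by simp
    then show ?thesis using cpos c0[OF k] by simp
  qed
  \<comment> \<open>Back in the original plane: \<open>K\<close> is the open half-plane with vertex
    \<open>i\<close> on its boundary line that contains all other vertices.\<close>
  define d where "d = cis (- \<phi>) / a"
  define K where "K = {w. Re (d * w) > Re (d * ?v)}"
  have "convex K"
  proof -
    have "K = {w. cnj d \<bullet> w > Re (d * ?v)}" by (simp add: K_def inner_complex_def)
    then show ?thesis by (simp add: convex_halfspace_gt)
  qed
  moreover have "vs ! k \<in> K" if "k \<in> J" for k
  proof -
    have "cis (- \<phi>) * c k = d * (vs ! k) - d * ?v" by (simp add: d_def c_def right_diff_distrib diff_divide_distrib)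
    then show ?thesis using half[OF that] by (simp add: K_def)
  qed
  then have "(!) vs ` J \<subseteq> K" by blast
  ultimately have "convex hull ((!) vs ` J) \<subseteq> K" by (intro hull_minimal)
  then have "?v \<notin> convex hull ((!) vs ` J)" by (auto simp: K_def)
  then have "?v extreme_point_of (convex hull (insert ?v ((!) vs ` J)))"
    using fJ by (intro extreme_point_of_convex_hull_insert) auto
  moreover have "insert ?v ((!) vs ` J) = set vs"
    using i unfolding J_def by (auto simp: set_conv_nth)
  moreover have "vs \<noteq> []" using i by auto
  ultimately show ?thesis by (simp add: hull_vertex_def convex_hull_polygon_region)
qed

section \<open>Transfer between the two polygons\<close>

lemma same_zp_info_tail:
  assumes "same_zp_info vs vs'" "i < length vs" "j < length vs" "i \<noteq> j"
  shows "tail_count vs i j = 0 \<longleftrightarrow> tail_count vs' i j = 0"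
    and "odd (tail_count vs i j) \<longleftrightarrow> odd (tail_count vs' i j)"
proof -
  have "zero_parity (tail_count vs i j) = zero_parity (tail_count vs' i j)"
    using assms by (auto simp: same_zp_info_def zp_info_def)
  then show "tail_count vs i j = 0 \<longleftrightarrow> tail_count vs' i j = 0"
    and "odd (tail_count vs i j) \<longleftrightarrow> odd (tail_count vs' i j)"
    by (auto simp: zero_parity_def split: if_splits)
qed

theorem lemma1:
  fixes P P' :: "complex list"
  assumes "ccw_simple_polygon P" and "general_position P"
    and "ccw_simple_polygon P'" and "general_position P'"
    and "length P' = length P"
    and "same_zp_info P P'"
  shows "\<forall>i<length P.
           (convex_vertex P i \<longleftrightarrow> convex_vertex P' i) \<and>
           (\<not> convex_vertex P i \<longrightarrow> reflex_vertex P i \<and> reflex_vertex P' i) \<and>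
           (hull_vertex P i \<longleftrightarrow> hull_vertex P' i)"
proof (intro allI impI)
  fix i assume i: "i < length P"
  have n: "length P \<ge> 3" using assms(1) by (simp add: ccw_simple_polygon_def)
  have j: "Suc i mod length P < length P" "Suc i mod length P \<noteq> i"
    using Suc_mod_neq[OF i] n by auto
  note tail = same_zp_info_tail[OF assms(6) i]
  have "odd (tail_count P i (Suc i mod length P)) \<longleftrightarrow> odd (tail_count P' i (Suc i mod length P))"
    using tail(2)[OF j(1) j(2)[symmetric]] .
  then have angle: "(convex_vertex P i \<longleftrightarrow> convex_vertex P' i) \<and>
      (\<not> convex_vertex P i \<longrightarrow> reflex_vertex P i \<and> reflex_vertex P' i)"
    using interior_angle_tail_parity[OF assms(1,2) i]
      interior_angle_tail_parity[OF assms(3,4), of i] i assms(5)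
    by (auto simp: convex_vertex_def reflex_vertex_def split: if_splits)
  have "hull_vertex P i \<longleftrightarrow> (\<forall>j<length P. j \<noteq> i \<longrightarrow> tail_count P i j = 0)"
    using hull_vertex_tail_zero[OF _ assms(2) n i] tail_zero_hull_vertex[OF assms(2) n i] by blast
  also have "\<dots> \<longleftrightarrow> (\<forall>j<length P. j \<noteq> i \<longrightarrow> tail_count P' i j = 0)"
    using tail(1) by blast
  also have "\<dots> \<longleftrightarrow> hull_vertex P' i"
    using hull_vertex_tail_zero[of P' i] tail_zero_hull_vertex[of P' i] assms(4,5) n i by auto
  finally show "(convex_vertex P i \<longleftrightarrow> convex_vertex P' i) \<and>
      (\<not> convex_vertex P i \<longrightarrow> reflex_vertex P i \<and> reflex_vertex P' i) \<and>
      (hull_vertex P i \<longleftrightarrow> hull_vertex P' i)"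
    using angle by blast
qed

end
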